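(* Let $\mathbb{F}$ be a field in which every quadratic and every cubic polynomial has a root. Any two-dimensional algebra over $\mathbb{F}$ has exactly one, exactly two, exactly three or infinitely many nontrivial (that is, one-dimensional) subalgebras. If it has infinitely many, then every one-dimensional subspace is a subalgebra.
   Context: An algebra is a vector space with a bilinear product (not necessarily associative, commutative or unital). *)

theory Defs
  imports "HOL-Computational_Algebra.Polynomial"
begin

text \<open>Algebras in the sense of vector spaces with a bilinear product; the product need not be
  associative, commutative or unital. The underlying vector space is the whole type.\<close>

locale bilinear_algebra = vector_space scale
  for scale :: "'f::field \<Rightarrow> 'v::ab_group_add \<Rightarrow> 'v" +
  fixes mult :: "'v \<Rightarrow> 'v \<Rightarrow> 'v"
  assumes linear_mult_right: "\<And>x. Vector_Spaces.linear scale scale (\<lambda>y. mult x y)"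
    and linear_mult_left: "\<And>y. Vector_Spaces.linear scale scale (\<lambda>x. mult x y)"
begin

definition subalgebra :: "'v set \<Rightarrow> bool"
  where "subalgebra S \<longleftrightarrow> subspace S \<and> (\<forall>x\<in>S. \<forall>y\<in>S. mult x y \<in> S)"

definition one_dim_subalgebras :: "'v set set"
  where "one_dim_subalgebras = {S. subalgebra S \<and> dim S = 1}"

end

end

theory Submission
  imports Defs
begin

text \<open>Fix a basis \<open>e\<^sub>1, e\<^sub>2\<close>. The line through \<open>x = a e\<^sub>1 + b e\<^sub>2\<close> is a subalgebra iff \<open>x\<close> and \<open>x x\<close> are
  linearly dependent, which is the vanishing of a binary cubic form in \<open>(a, b)\<close>. So the
  one-dimensional subalgebras are the points of the projective line at which this form vanishes:
  either the form is zero and every line is a subalgebra, or there are between one and three zeros.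
  In the former case there are infinitely many lines, because over a finite field \<open>x \<mapsto> x\<^sup>2 - x\<close> is
  not injective, hence not surjective, and some quadratic polynomial has no root.\<close>

lemma infinite_UNIV_if_quadratic_roots:
  assumes "\<And>p :: 'f::field poly. degree p = 2 \<Longrightarrow> \<exists>x. poly p x = 0"
  shows "infinite (UNIV :: 'f set)"
proof
  assume fin: "finite (UNIV :: 'f set)"
  have "\<exists>x :: 'f. c = x * x - x" for c
  proof -
    have "degree [:- c, - 1, 1:] = 2"
      by simp
    then obtain x where "poly [:- c, - 1, 1:] x = 0"
      using assms by blast
    then show ?thesis
      by (auto simp: algebra_simps intro!: exI[of _ x])
  qed
  then have "surj (\<lambda>x :: 'f. x * x - x)"
    by (simp add: surj_def)
  with fin have "inj (\<lambda>x :: 'f. x * x - x)"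
    using finite_UNIV_surj_inj by blast
  \<comment> \<open>Both \<open>0\<close> and \<open>1\<close> are sent to \<open>0\<close>.\<close>
  then have "(0 :: 'f) = 1"
    by (rule injD) simp
  then show False
    by simp
qed

section \<open>Lines and two-element bases\<close>

context vector_space
begin

lemma in_span_singleton_iff: "y \<in> span {x} \<longleftrightarrow> (\<exists>k. y = scale k x)"
  by (auto simp: span_singleton)

lemma span_singleton_scale:
  assumes "k \<noteq> 0"
  shows "span {scale k x} = span {x}"
proof -
  have "scale c x = scale (c / k) (scale k x)" for c
    using assms by simp
  then show ?thesis
    unfolding set_eq_iff in_span_singleton_iff by (metis scale_scale)
qed

lemma subspace_dim_1_iff: "subspace S \<and> dim S = 1 \<longleftrightarrow> (\<exists>x. x \<noteq> 0 \<and> S = span {x})"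
proof
  assume S: "subspace S \<and> dim S = 1"
  obtain B where B: "B \<subseteq> S" "independent B" "S \<subseteq> span B" "card B = dim S"
    using basis_exists by metis
  obtain x where "B = {x}"
    using B S by (metis card_1_singletonE)
  moreover have "span B = S"
    using B S by (metis span_subspace)
  ultimately show "\<exists>x. x \<noteq> 0 \<and> S = span {x}"
    using B by (metis dependent_zero singletonI)
next
  assume "\<exists>x. x \<noteq> 0 \<and> S = span {x}"
  then obtain x where "x \<noteq> 0" "S = span {x}"
    by blast
  then show "subspace S \<and> dim S = 1"
    by (simp add: dim_eq_card_independent)
qed

text \<open>Supplies a basis in coordinate form, matching the assumptions of
  \<open>two_dim_algebra\<close>.\<close>

lemma dim_2_basis:
  assumes "dim UNIV = 2"
  obtains u v where "\<And>x. \<exists>a b. x = scale a u + scale b v"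
    and "\<And>a b. scale a u + scale b v = 0 \<Longrightarrow> a = 0 \<and> b = 0"
proof -
  obtain B where B: "independent B" "UNIV \<subseteq> span B" "card B = 2"
    using basis_exists[of UNIV] assms by metis
  \<comment> \<open>Infinite sets have \<open>card\<close> 0, so the value 2 makes \<open>B\<close>
    a genuine pair.\<close>
  then obtain u v where uv: "B = {u, v}" "u \<noteq> v"
    by (meson card_2_iff)
  show thesis
  proof
    fix x
    have "x \<in> span {u, v}"
      using B uv by blast
    then obtain a b where "x - scale a u = scale b v"
      unfolding span_insert[of u] in_span_singleton_iff by blast
    then have "x = scale a u + scale b v"
      by (simp add: diff_eq_eq add.commute)
    then show "\<exists>a b. x = scale a u + scale b v"
      by blast
  next
    fix a b
    assume eq: "scale a u + scale b v = 0"
    have u: "u \<notin> span {v}" and v: "v \<noteq> 0"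
      using B uv by (auto simp: independent_insert)
    have "a = 0"
    proof (rule ccontr)
      assume "a \<noteq> 0"
      have "scale a u = scale (- b) v"
        using eq by (simp add: eq_neg_iff_add_eq_0)
      then have "scale (inverse a) (scale a u) \<in> span {v}"
        by (metis in_span_singleton_iff scale_scale)
      with \<open>a \<noteq> 0\<close> u show False
        by simp
    qed
    with eq v show "a = 0 \<and> b = 0"
      by simp
  qed
qed

end

context bilinear_algebra
begin

lemma mult_add_left: "mult (x + y) z = mult x z + mult y z"
  and mult_scale_left: "mult (scale a x) z = scale a (mult x z)"
  using linear_mult_left[of z] unfolding linear_iff_module_hom module_hom_iff by blast+

lemma mult_add_right: "mult z (x + y) = mult z x + mult z y"
  and mult_scale_right: "mult z (scale a x) = scale a (mult z x)"
  using linear_mult_right[of z] unfolding linear_iff_module_hom module_hom_iff by blast+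

text \<open>By bilinearity, (c x)(d x) = (c d)(x x), so only the square of the generator has to be
  tested.\<close>

lemma subalgebra_span_singleton: "subalgebra (span {x}) \<longleftrightarrow> mult x x \<in> span {x}"
proof
  assume "subalgebra (span {x})"
  then show "mult x x \<in> span {x}"
    by (simp add: subalgebra_def span_base)
next
  assume "mult x x \<in> span {x}"
  then have "scale c (mult x x) \<in> span {x}" for c
    by (rule span_scale)
  then show "subalgebra (span {x})"
    by (auto simp: subalgebra_def in_span_singleton_iff[of _ x] mult_scale_left mult_scale_right)
qed

end

section \<open>Coordinates and the projective line\<close>

locale two_dim_algebra = bilinear_algebra scale mult
  for scale :: "'f::field \<Rightarrow> 'v::ab_group_add \<Rightarrow> 'v" and mult +
  fixes u v :: 'v
  assumes spanning: "\<exists>a b. x = scale a u + scale b v"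
    and indep: "scale a u + scale b v = 0 \<Longrightarrow> a = 0 \<and> b = 0"
begin

definition vec :: "'f \<Rightarrow> 'f \<Rightarrow> 'v"
  where "vec a b = scale a u + scale b v"

lemma vec_exhaust: obtains a b where "x = vec a b"
  using spanning vec_def by metis

lemma vec_eq_0_iff: "vec a b = 0 \<longleftrightarrow> a = 0 \<and> b = 0"
  using indep by (auto simp: vec_def)

lemma vec_eq_iff: "vec a b = vec c d \<longleftrightarrow> a = c \<and> b = d"
proof
  assume "vec a b = vec c d"
  then have "vec (a - c) (b - d) = 0"
    by (simp add: vec_def scale_left_diff_distrib algebra_simps)
  then show "a = c \<and> b = d"
    by (simp add: vec_eq_0_iff)
qed simp

lemma scale_vec: "scale k (vec a b) = vec (k * a) (k * b)"
  by (simp add: vec_def scale_right_distrib)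

lemma vec_0_1: "vec 0 1 = v"
  by (simp add: vec_def)

text \<open>The expression is the 2 by 2 determinant of the two coordinate vectors. It turns
  membership in a line into a polynomial equation.\<close>

lemma vec_in_span_vec_iff:
  assumes "a \<noteq> 0 \<or> b \<noteq> 0"
  shows "vec c d \<in> span {vec a b} \<longleftrightarrow> a * d - b * c = 0"
proof
  assume "vec c d \<in> span {vec a b}"
  then show "a * d - b * c = 0"
    by (auto simp: in_span_singleton_iff scale_vec vec_eq_iff)
next
  assume eq: "a * d - b * c = 0"
  \<comment> \<open>The factor is read off at a nonzero coordinate; the determinant equation settles
    the other one.\<close>
  define k where "k = (if a \<noteq> 0 then c / a else d / b)"
  have "c = k * a \<and> d = k * b"
    using assms eq by (auto simp: k_def field_simps)
  then show "vec c d \<in> span {vec a b}"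
    by (metis in_span_singleton_iff scale_vec)
qed

text \<open>The projective line is the affine chart (1, t) together with the point (0, 1). By
  \<open>inj_line\<close> and \<open>span_v_not_line\<close> below, this lists each line
  once.\<close>

lemma line_cases:
  assumes "x \<noteq> 0"
  shows "span {x} = span {v} \<or> (\<exists>t. span {x} = span {vec 1 t})"
proof -
  obtain a b where x: "x = vec a b"
    by (rule vec_exhaust)
  show ?thesis
  proof (cases "a = 0")
    case True
    then have "x = scale b v" and "b \<noteq> 0"
      using assms by (auto simp: x vec_def)
    then show ?thesis
      by (simp add: span_singleton_scale)
  next
    case False
    then have "x = scale a (vec 1 (b / a))"
      by (simp add: x scale_vec)
    with False show ?thesis
      by (metis span_singleton_scale)
  qed
qed

lemma vec_1_nonzero: "vec 1 t \<noteq> 0"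
  by (simp add: vec_eq_0_iff)

lemma v_nonzero: "v \<noteq> 0"
  using vec_eq_0_iff[of 0 1] by (simp add: vec_0_1)

lemma inj_line: "inj (\<lambda>t. span {vec 1 t})"
proof (rule injI)
  fix s t
  assume "span {vec 1 s} = span {vec 1 t}"
  then have "vec 1 s \<in> span {vec 1 t}"
    by (metis span_base singletonI)
  then show "s = t"
    by (simp add: vec_in_span_vec_iff)
qed

lemma span_v_not_line: "span {v} \<noteq> span {vec 1 t}"
proof
  assume "span {v} = span {vec 1 t}"
  then have "vec 0 1 \<in> span {vec 1 t}"
    using span_base[of v "{v}"] by (simp add: vec_0_1)
  then show False
    using vec_in_span_vec_iff[of 1 t 0 1] by simp
qed

text \<open>The polynomial \<open>p\<close> is the cubic form restricted to \<open>(1, t)\<close>; its coefficient of \<open>t\<^sup>3\<close> is the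
  value of the form at the remaining point \<open>(0, 1)\<close>.\<close>

lemma subalgebra_polynomial:
  obtains p where "degree p \<le> 3"
    and "\<And>t. subalgebra (span {vec 1 t}) \<longleftrightarrow> poly p t = 0"
    and "subalgebra (span {v}) \<longleftrightarrow> coeff p 3 = 0"
proof -
  obtain a1 b1 where uu: "mult u u = vec a1 b1"
    by (rule vec_exhaust)
  \<comment> \<open>A square involves the mixed products only through their sum.\<close>
  obtain a2 b2 where uv: "mult u v + mult v u = vec a2 b2"
    by (rule vec_exhaust)
  obtain a3 b3 where vv: "mult v v = vec a3 b3"
    by (rule vec_exhaust)
  \<comment> \<open>This is the determinant of (1, t) and the coordinates of its square: b1 + t b2 +
    t^2 b3 - t (a1 + t a2 + t^2 a3).\<close>
  define p where "p = [:b1, b2 - a1, b3 - a2, - a3:]"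
  show thesis
  proof
    show "degree p \<le> 3"
      by (simp add: p_def)
    show "subalgebra (span {vec 1 t}) \<longleftrightarrow> poly p t = 0" for t
    proof -
      have "mult (vec 1 t) (vec 1 t)
          = mult u u + scale t (mult u v + mult v u) + scale (t * t) (mult v v)"
        by (simp add: vec_def mult_add_left mult_add_right mult_scale_left mult_scale_right
            scale_right_distrib algebra_simps)
      also have "\<dots> = vec (a1 + t * a2 + t * t * a3) (b1 + t * b2 + t * t * b3)"
        by (simp add: uu uv vv vec_def scale_right_distrib scale_left_distrib algebra_simps)
      finally show ?thesis
        by (simp add: subalgebra_span_singleton vec_in_span_vec_iff p_def algebra_simps)
    qed
    show "subalgebra (span {v}) \<longleftrightarrow> coeff p 3 = 0"
      using vec_in_span_vec_iff[of 0 1 a3 b3]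
      by (simp add: subalgebra_span_singleton vec_0_1 vv p_def numeral_3_eq_3)
  qed
qed

section \<open>Counting the zeros of the cubic form\<close>

lemma one_dim_subalgebras_eq:
  "one_dim_subalgebras = (\<lambda>t. span {vec 1 t}) ` {t. subalgebra (span {vec 1 t})} \<union>
    (if subalgebra (span {v}) then {span {v}} else {})"
proof -
  have "S \<in> one_dim_subalgebras \<longleftrightarrow> subalgebra S \<and> (\<exists>x. x \<noteq> 0 \<and> S = span {x})" for S
    unfolding one_dim_subalgebras_def
    using subspace_dim_1_iff[of S] by (auto simp: subalgebra_def)
  moreover have "(\<exists>x. x \<noteq> 0 \<and> S = span {x}) \<longleftrightarrow> S = span {v} \<or> (\<exists>t. S = span {vec 1 t})" for S
    using line_cases vec_1_nonzero v_nonzero by metis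
  ultimately show ?thesis
    by auto
qed

lemma one_dim_subalgebras_alternative:
  assumes inf: "infinite (UNIV :: 'f set)"
    and cubic: "\<And>p :: 'f poly. degree p = 3 \<Longrightarrow> \<exists>x. poly p x = 0"
  shows "card one_dim_subalgebras \<in> {1, 2, 3} \<and> finite one_dim_subalgebras \<or>
    infinite one_dim_subalgebras \<and> (\<forall>S. subspace S \<and> dim S = 1 \<longrightarrow> subalgebra S)"
proof -
  obtain p where deg: "degree p \<le> 3"
    and lines: "\<And>t. subalgebra (span {vec 1 t}) \<longleftrightarrow> poly p t = 0"
    and v: "subalgebra (span {v}) \<longleftrightarrow> coeff p 3 = 0"
    by (rule subalgebra_polynomial) blast
  define R where "R = {t. poly p t = 0}"
  have inj: "inj_on (\<lambda>t. span {vec 1 t}) R"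
    using inj_line by (rule inj_on_subset) simp
  have eq: "one_dim_subalgebras
      = (\<lambda>t. span {vec 1 t}) ` R \<union> (if coeff p 3 = 0 then {span {v}} else {})"
    unfolding one_dim_subalgebras_eq lines v R_def ..
  show ?thesis
  proof (cases "p = 0")
    case True
    \<comment> \<open>Here \<open>R\<close> is the whole field, and distinct parameters give
      distinct lines.\<close>
    then have "infinite one_dim_subalgebras"
      using inf inj by (simp add: eq R_def finite_image_iff)
    moreover have "subalgebra S" if "subspace S \<and> dim S = 1" for S
      using that line_cases lines v True unfolding subspace_dim_1_iff
      by (metis coeff_0 poly_0)
    ultimately show ?thesis
      by blast
  next
    case False
    have fin: "finite R" and card: "card R \<le> degree p"
      using False by (simp_all add: R_def poly_roots_finite card_poly_roots_bound)
    have "card one_dim_subalgebras \<in> {1, 2, 3}"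
    proof (cases "coeff p 3 = 0")
      case True
      \<comment> \<open>The leading coefficient of the nonzero \<open>p\<close> cannot vanish. So
        \<open>p\<close> has at most two roots, and \<open>span {v}\<close> adds exactly one
        line.\<close>
      have "degree p \<noteq> 3"
        using True False leading_coeff_0_iff by metis
      moreover have "span {v} \<notin> (\<lambda>t. span {vec 1 t}) ` R"
        using span_v_not_line by blast
      then have "card one_dim_subalgebras = Suc (card R)"
        using True fin by (simp add: eq card_image inj)
      ultimately show ?thesis
        using deg card by auto
    next
      case False
      then have "degree p = 3"
        using deg by (simp add: le_antisym le_degree)
      \<comment> \<open>Now \<open>span {v}\<close> is not a subalgebra, so the lower bound 1 has to
        come from a root of the cubic.\<close>
      then have "R \<noteq> {}"
        using cubic by (simp add: R_def)
      with fin have "card R > 0"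
        by (simp add: card_gt_0_iff)
      moreover have "card one_dim_subalgebras = card R"
        using False by (simp add: eq card_image inj)
      ultimately show ?thesis
        using deg card by auto
    qed
    then show ?thesis
      using fin by (simp add: eq)
  qed
qed

end

theorem corollary3p2:
  fixes scale :: "'f::field \<Rightarrow> 'v::ab_group_add \<Rightarrow> 'v"
    and mult :: "'v \<Rightarrow> 'v \<Rightarrow> 'v"
  assumes quadratic_root: "\<And>p :: 'f poly. degree p = 2 \<Longrightarrow> \<exists>x. poly p x = 0"
    and cubic_root: "\<And>p :: 'f poly. degree p = 3 \<Longrightarrow> \<exists>x. poly p x = 0"
    and alg: "bilinear_algebra scale mult"
    and dim2: "vector_space.dim scale (UNIV :: 'v set) = 2"
  shows "(card (bilinear_algebra.one_dim_subalgebras scale mult) \<in> {1, 2, 3} \<or>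
      infinite (bilinear_algebra.one_dim_subalgebras scale mult)) \<and>
    (infinite (bilinear_algebra.one_dim_subalgebras scale mult) \<longrightarrow>
      (\<forall>S. module.subspace scale S \<and> vector_space.dim scale S = 1 \<longrightarrow>
        bilinear_algebra.subalgebra scale mult S))"
proof -
  interpret bilinear_algebra scale mult
    by (fact alg)
  obtain u v where "\<And>x. \<exists>a b. x = scale a u + scale b v"
    and "\<And>a b. scale a u + scale b v = 0 \<Longrightarrow> a = 0 \<and> b = 0"
    using dim2 by (rule dim_2_basis) blast
  then interpret two_dim_algebra scale mult u v
    by unfold_locales
  \<comment> \<open>This makes the zero form yield infinitely many subalgebras; a finite field with
    q elements would give q + 1.\<close>
  have "infinite (UNIV :: 'f set)"
    using quadratic_root by (rule infinite_UNIV_if_quadratic_roots)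
  with cubic_root show ?thesis
    using one_dim_subalgebras_alternative by blast
qed

end
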